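(* For any finite sequence $X\in\{\pm1\}^s$ and any nonnegative integers $d'\le d$ and $b'\le b$, $$c^{X}(d',b')-c^{X}(d,b)=c^{X(d,b)}(d',b')-c^{X(d,b)}(d,b)=c^{X(d,b)}(d',b').$$
   Context: For a finite sequence $X=(X_1,\dots,X_s)\in\{\pm1\}^s$ ($X_t=1$: a customer attempts to return a bike, $X_t=-1$: a customer attempts to rent a bike) and integers $d,b\ge0$ (initial numbers of empty docks and of bikes at a station), let $\delta_0=d$ and $\delta_t=\max\{0,\min\{d+b,\delta_{t-1}-X_t\}\}$ be the number of empty docks after the $t$-th arrival. Customer $t$ experiences an out-of-stock event if either $X_t=1$ and $\delta_{t-1}=0$, or $X_t=-1$ and $\delta_{t-1}=d+b$. $c^X(d,b)$ is the number of customers in $X$ experiencing an out-of-stock event. $X(d,b)$ denotes the subsequence of $X$ consisting of exactly those customers who do not experience an out-of-stock event when the station is initialized with $d$ empty docks and $b$ bikes and faces the sequence $X$. *)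

theory Defs
  imports Main
begin

text \<open>
  A customer sequence is an integer list with entries in \<open>{1, -1}\<close>: an entry \<open>1\<close> attempts
  to return a bike, \<open>-1\<close> attempts to rent one. List positions start at 0, so the \<open>t\<close>-th arrival
  is \<open>X ! (t - 1)\<close>, and \<open>empty_docks X d b t\<close> is the number of empty docks after the first
  \<open>t\<close> arrivals; it is only meaningful for \<open>t \<le> length X\<close>.
\<close>

primrec empty_docks :: "int list \<Rightarrow> nat \<Rightarrow> nat \<Rightarrow> nat \<Rightarrow> int" where
  "empty_docks X d b 0 = int d"
| "empty_docks X d b (Suc t) = max 0 (min (int d + int b) (empty_docks X d b t - X ! t))"

text \<open>The position \<open>t\<close> below is 0-based: \<open>empty_docks X d b t\<close> is the state that the customer
  \<open>X ! t\<close> finds on arrival.\<close>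

definition out_of_stock :: "int list \<Rightarrow> nat \<Rightarrow> nat \<Rightarrow> nat \<Rightarrow> bool" where
  "out_of_stock X d b t \<longleftrightarrow>
     X ! t = 1 \<and> empty_docks X d b t = 0 \<or>
     X ! t = -1 \<and> empty_docks X d b t = int d + int b"

definition cost :: "int list \<Rightarrow> nat \<Rightarrow> nat \<Rightarrow> nat" where
  "cost X d b = card {t. t < length X \<and> out_of_stock X d b t}"

definition served :: "int list \<Rightarrow> nat \<Rightarrow> nat \<Rightarrow> int list" where
  "served X d b = nths X {t. \<not> out_of_stock X d b t}"

end

theory Submission
  imports Defs
begin

text \<open>
  Run the large station \<open>(d, b)\<close> and the small station \<open>(d', b')\<close> side by side on the same
  customers. The inequalities \<open>d' \<le> d\<close> and \<open>b' \<le> b\<close> between the current numbers of docks and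
  of bikes persist after every arrival. Hence a customer whom the large station turns away is
  turned away by the small one as well, and changes neither state: deleting this customer lowers
  the cost at both stations by exactly one and leaves the rest of both runs as it was. Deleting
  all of them gives the additive law
  \[c^X(d', b') = c^X(d, b) + c^{X(d,b)}(d', b')\]
  of \<open>cost_eq_cost_plus_cost_served\<close>. It is the whole theorem: taking \<open>d' = d\<close>, \<open>b' = b\<close> shows
  that the large station serves everyone in \<open>X(d, b)\<close>.

  The coupling is an induction on the list from its head, whereas the state is defined by
  recursion on time. The two are reconciled by restarting the station after the first arrival
  with the docks and bikes it then has (\<open>empty_docks_Cons_Suc\<close>).
\<close>

lemma empty_docks_Cons_Suc:
  assumes "int d\<^sub>1 = max 0 (min (int d + int b) (int d - a))" "d\<^sub>1 + b\<^sub>1 = d + b"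
  shows "empty_docks (a # X) d b (Suc t) = empty_docks X d\<^sub>1 b\<^sub>1 t"
proof -
  have capacity: "int d + int b = int d\<^sub>1 + int b\<^sub>1"
    using assms(2) by linarith
  show ?thesis
  proof (induction t)
    case 0
    show ?case using assms(1) by simp
  next
    case (Suc t)
    then show ?case using capacity by simp
  qed
qed

lemma out_of_stock_Cons_Suc:
  assumes "int d\<^sub>1 = max 0 (min (int d + int b) (int d - a))" "d\<^sub>1 + b\<^sub>1 = d + b"
  shows "out_of_stock (a # X) d b (Suc t) \<longleftrightarrow> out_of_stock X d\<^sub>1 b\<^sub>1 t"
proof -
  have "int d + int b = int d\<^sub>1 + int b\<^sub>1"
    using assms(2) by linarith
  then show ?thesis
    unfolding out_of_stock_def empty_docks_Cons_Suc[OF assms] by simp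
qed

lemma cost_Nil: "cost [] d b = 0"
  by (simp add: cost_def)

lemma cost_Cons:
  assumes "int d\<^sub>1 = max 0 (min (int d + int b) (int d - a))" "d\<^sub>1 + b\<^sub>1 = d + b"
  shows "cost (a # X) d b = of_bool (out_of_stock (a # X) d b 0) + cost X d\<^sub>1 b\<^sub>1"
proof -
  let ?later = "{t. t < length X \<and> out_of_stock X d\<^sub>1 b\<^sub>1 t}"
  have "{t. t < length (a # X) \<and> out_of_stock (a # X) d b t}
      = (if out_of_stock (a # X) d b 0 then {0} else {}) \<union> Suc ` ?later" (is "?L = ?R")
  proof (rule set_eqI)
    fix t
    show "t \<in> ?L \<longleftrightarrow> t \<in> ?R"
      by (cases t) (auto simp: out_of_stock_Cons_Suc[OF assms])
  qed
  then show ?thesis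
    unfolding cost_def by (simp add: card_image)
qed

lemma served_Cons:
  assumes "int d\<^sub>1 = max 0 (min (int d + int b) (int d - a))" "d\<^sub>1 + b\<^sub>1 = d + b"
  shows "served (a # X) d b
    = (if out_of_stock (a # X) d b 0 then [] else [a]) @ served X d\<^sub>1 b\<^sub>1"
  by (simp add: served_def nths_Cons out_of_stock_Cons_Suc[OF assms])

text \<open>The four possible first arrivals: a return or a rental, turned away or served.\<close>

lemma cost_return:
  "cost (1 # X) 0 b = Suc (cost X 0 b)"
  "cost (1 # X) (Suc d) b = cost X d (Suc b)"
  by (simp_all add: cost_Cons[of 0 0 b 1 b] cost_Cons[of d "Suc d" b 1 "Suc b"] out_of_stock_def)

lemma cost_rental:
  "cost (-1 # X) d 0 = Suc (cost X d 0)"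
  "cost (-1 # X) d (Suc b) = cost X (Suc d) b"
  by (simp_all add: cost_Cons[of d d 0 "-1" 0] cost_Cons[of "Suc d" d "Suc b" "-1" b]
      out_of_stock_def)

lemma served_return:
  "served (1 # X) 0 b = served X 0 b"
  "served (1 # X) (Suc d) b = 1 # served X d (Suc b)"
  by (simp_all add: served_Cons[of 0 0 b 1 b] served_Cons[of d "Suc d" b 1 "Suc b"]
      out_of_stock_def)

lemma served_rental:
  "served (-1 # X) d 0 = served X d 0"
  "served (-1 # X) d (Suc b) = -1 # served X (Suc d) b"
  by (simp_all add: served_Cons[of d d 0 "-1" 0] served_Cons[of "Suc d" d "Suc b" "-1" b]
      out_of_stock_def)

text \<open>
  The coupling. If the large station has no dock (no bike) for the customer, neither has the
  small one, so both sides of the equation grow by one. If only the small station is out of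
  stock, the large one moves one dock or bike to the other side, and the inequalities survive
  because the small station had none of what the large one gives up. In the remaining case both
  states move by the same amount.
\<close>

lemma cost_eq_cost_plus_cost_served:
  assumes "set X \<subseteq> {1, -1}" "d' \<le> d" "b' \<le> b"
  shows "cost X d' b' = cost X d b + cost (served X d b) d' b'"
  using assms
proof (induction X arbitrary: d b d' b')
  case Nil
  then show ?case by (simp add: served_def cost_Nil)
next
  case (Cons a X)
  have X: "set X \<subseteq> {1, -1}" using Cons.prems(1) by simp
  note IH = Cons.IH[OF X]
  consider "a = 1" | "a = -1" using Cons.prems(1) by auto
  then show ?case
  proof cases
    case 1
    show ?thesis
    proof (cases d)
      case 0
      then show ?thesis
        using 1 Cons.prems(2,3) IH[of 0 0 b' b] by (simp add: cost_return served_return)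
    next
      case (Suc m)
      then show ?thesis
        using 1 Cons.prems(2,3) IH[of "d' - 1" m "Suc b'" "Suc b"] IH[of 0 m b' "Suc b"]
        by (cases d') (simp_all add: cost_return served_return)
    qed
  next
    case 2
    show ?thesis
    proof (cases b)
      case 0
      then show ?thesis
        using 2 Cons.prems(2,3) IH[of d' d 0 0] by (simp add: cost_rental served_rental)
    next
      case (Suc m)
      then show ?thesis
        using 2 Cons.prems(2,3) IH[of "Suc d'" "Suc d" "b' - 1" m] IH[of d' "Suc d" 0 m]
        by (cases b') (simp_all add: cost_rental served_rental)
    qed
  qed
qed

theorem proposition2:
  fixes X :: "int list" and d b d' b' :: nat
  assumes "set X \<subseteq> {1, -1}"
    and "d' \<le> d" and "b' \<le> b"
  shows "int (cost X d' b') - int (cost X d b)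
           = int (cost (served X d b) d' b') - int (cost (served X d b) d b)
       \<and> int (cost (served X d b) d' b') - int (cost (served X d b) d b)
           = int (cost (served X d b) d' b')"
  using cost_eq_cost_plus_cost_served[OF assms]
    cost_eq_cost_plus_cost_served[OF assms(1) order_refl order_refl, of d b]
  by simp

end
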